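(* Let $H$ be a quasitriangular Hopf $*$-algebra with universal R-matrix $\mathcal R$, and let $\psi_{UV}=\tau\circ\mathcal R:U\otimes V\to V\otimes U$ be the associated braiding on left $H$-modules. Let $V$ be a $*$-module over $H$, and give $V\otimes V$ the $*$-structure $(\overline{u\otimes v})^*=\bar v^{\,*}\otimes\bar u^{\,*}$. If $\mathcal R$ is real, then $\psi_{VV}\circ *=*\circ\overline{\psi_{VV}}$ as maps $\overline{V\otimes V}\to V\otimes V$, so $\psi_{VV}$ is a morphism of $*$-modules. (Here $\overline{\psi_{VV}}:\overline{V\otimes V}\to\overline{V\otimes V}$ is the complex conjugate of the map $\psi_{VV}$.)
   Context: All vector spaces are over $\mathbb{C}$. A Hopf $*$-algebra is a Hopf algebra $H$ over $\mathbb{C}$ (coproduct $\Delta(a)=a_{(1)}\otimes a_{(2)}$, counit $\varepsilon$, antipode $S$) equipped with an antilinear map $*:H\to H$ such that $(a^* )^*=a$, $(ab)^*=b^*a^*$ and $\Delta(a^* )=a_{(1)}^*\otimes a_{(2)}^*$. Tensor products of modules carry the action $a\rhd(v\otimes w)=(a_{(1)}\rhd v)\otimes(a_{(2)}\rhd w)$. $H$ is quasitriangular with universal R-matrix $\mathcal R$ if $\mathcal R\in H\otimes H$ is invertible, $\mathcal R\Delta(a)\mathcal R^{-1}=\tau(\Delta(a))$ for all $a\in H$, where $\tau$ is the tensor flip, and $(\Delta\otimes\mathrm{id})(\mathcal R)=\mathcal R_{13}\mathcal R_{23}$, $(\mathrm{id}\otimes\Delta)(\mathcal R)=\mathcal R_{13}\mathcal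 R_{12}$ (leg-numbering notation). $\mathcal R$ acts coordinate-wise on $U\otimes V$. Extend $*$ to $H\otimes H$ by $(a\otimes b)^*=a^*\otimes b^*$; $\mathcal R$ is real if $\mathcal R^*=\mathcal R_{21}:=\tau(\mathcal R)$. For a vector space $V$, the complex conjugate vector space $\overline{V}$ consists of formal symbols $\bar v$ ($v\in V$) with $\bar v+\bar w=\overline{v+w}$ and $\lambda\cdot\bar v=\overline{\bar\lambda v}$. For a linear map $T:V\to W$, $\overline T(\bar v)=\overline{T(v)}$. If $V$ is a left $H$-module, $\overline V$ is a left $H$-module via $a\rhd\bar v=\overline{S(a)^*\rhd v}$. Let $\sigma_V:\overline{\overline V}\to V$, $\bar{\bar v}\mapsto v$. A $*$-structure on an $H$-module $V$ is a module map $*:\overline V\to V$ with $*\circ\overline{*}=\sigma_V$; then $V$ is a $*$-module, and $*(\bar v)$ is written $\bar v^{\,*}$. A morphism of $*$-modules is a module map $T:V\to W$ with $T\circ *=*\circ\overline T$. *)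

theory Defs
  imports Complex_Main "HOL-Library.Poly_Mapping"
begin

section \<open>Complex vector spaces and algebras\<close>

class complex_vector = ab_group_add +
  fixes scaleC :: "complex \<Rightarrow> 'a \<Rightarrow> 'a" (infixr \<open>*\<^sub>C\<close> 75)
  assumes scaleC_add_right: "c *\<^sub>C (x + y) = c *\<^sub>C x + c *\<^sub>C y"
    and scaleC_add_left: "(c + d) *\<^sub>C x = c *\<^sub>C x + d *\<^sub>C x"
    and scaleC_scaleC: "c *\<^sub>C d *\<^sub>C x = (c * d) *\<^sub>C x"
    and scaleC_one: "1 *\<^sub>C x = x"

interpretation complex_vector: vector_space "scaleC :: complex \<Rightarrow> 'a \<Rightarrow> 'a::complex_vector"
  by standard (rule scaleC_add_right scaleC_add_left scaleC_scaleC scaleC_one)+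

(* Associative and unital; unlike ring_1 it admits the zero algebra, so that tensor products
   of algebras are instances without a nontriviality argument. *)
class complex_algebra_1 = complex_vector + ring + monoid_mult +
  assumes scaleC_mult_left: "(c *\<^sub>C x) * y = c *\<^sub>C (x * y)"
    and scaleC_mult_right: "x * (c *\<^sub>C y) = c *\<^sub>C (x * y)"

instantiation complex :: complex_algebra_1
begin
definition scaleC_complex_def: "scaleC c (x::complex) = c * x"
instance by standard (simp_all add: scaleC_complex_def algebra_simps)
end

abbreviation clinear :: "('a::complex_vector \<Rightarrow> 'b::complex_vector) \<Rightarrow> bool"
  where "clinear \<equiv> Vector_Spaces.linear scaleC scaleC"

definition cbilinear ::
    "('a::complex_vector \<Rightarrow> 'b::complex_vector \<Rightarrow> 'c::complex_vector) \<Rightarrow> bool"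
  where "cbilinear B \<longleftrightarrow> (\<forall>b. clinear (\<lambda>a. B a b)) \<and> (\<forall>a. clinear (B a))"

lemma clinear_iff:
  "clinear f \<longleftrightarrow> (\<forall>x y. f (x + y) = f x + f y) \<and> (\<forall>c x. f (c *\<^sub>C x) = c *\<^sub>C f x)"
  unfolding Vector_Spaces.linear_def module_hom_def module_hom_axioms_def
  by (simp add: complex_vector.vector_space_axioms complex_vector.module_axioms)

lemma clinear_add: "clinear f \<Longrightarrow> f (x + y) = f x + f y"
  and clinear_scaleC: "clinear f \<Longrightarrow> f (c *\<^sub>C x) = c *\<^sub>C f x"
  by (auto simp: clinear_iff)

lemma clinear_zero: "clinear f \<Longrightarrow> f 0 = 0"
  using clinear_add[of f 0 0] by simp

lemma clinear_diff: "clinear f \<Longrightarrow> f (x - y) = f x - f y"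
  by (metis clinear_add add_diff_cancel diff_add_cancel)

lemma cbilinear_iff:
  "cbilinear B \<longleftrightarrow>
    (\<forall>a a' b. B (a + a') b = B a b + B a' b) \<and> (\<forall>c a b. B (c *\<^sub>C a) b = c *\<^sub>C B a b) \<and>
    (\<forall>a b b'. B a (b + b') = B a b + B a b') \<and> (\<forall>c a b. B a (c *\<^sub>C b) = c *\<^sub>C B a b)"
  unfolding cbilinear_def clinear_iff by blast


section \<open>The complex conjugate vector space\<close>

datatype 'a conj_space = bar (unbar: 'a)

instantiation conj_space :: (complex_vector) complex_vector
begin
definition zero_conj_space_def: "0 = bar 0"
definition plus_conj_space_def: "x + y = bar (unbar x + unbar y)"
definition minus_conj_space_def: "x - y = bar (unbar x - unbar y)"
definition uminus_conj_space_def: "- x = bar (- unbar x)"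
definition scaleC_conj_space_def: "c *\<^sub>C x = bar (cnj c *\<^sub>C unbar x)"
instance
  by standard (simp_all add: zero_conj_space_def plus_conj_space_def minus_conj_space_def
      uminus_conj_space_def scaleC_conj_space_def algebra_simps)
end

definition conj_map :: "('a \<Rightarrow> 'b) \<Rightarrow> 'a conj_space \<Rightarrow> 'b conj_space"
  where "conj_map T x = bar (T (unbar x))"

definition double_conj :: "'a conj_space conj_space \<Rightarrow> 'a"
  where "double_conj x = unbar (unbar x)"

lemma bar_add: "bar (x + y) = bar x + bar y"
  and bar_scaleC: "bar (c *\<^sub>C x) = cnj c *\<^sub>C bar x"
  and unbar_add: "unbar (p + q) = unbar p + unbar q"
  and unbar_scaleC: "unbar (c *\<^sub>C p) = cnj c *\<^sub>C unbar p"
  by (simp_all add: plus_conj_space_def scaleC_conj_space_def)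


section \<open>Algebraic tensor products\<close>

text \<open>The free complex vector space on \<open>'a \<times> 'b\<close> (finitely supported functions) modulo the span
  of the bilinearity relations.\<close>

definition free_scale :: "complex \<Rightarrow> ('x \<Rightarrow>\<^sub>0 complex) \<Rightarrow> ('x \<Rightarrow>\<^sub>0 complex)"
  where "free_scale c f = Poly_Mapping.map ((*) c) f"

lemma lookup_free_scale: "Poly_Mapping.lookup (free_scale c f) x = c * Poly_Mapping.lookup f x"
  by (simp add: free_scale_def Poly_Mapping.map.rep_eq when_def)

interpretation free: vector_space "free_scale :: complex \<Rightarrow> ('x \<Rightarrow>\<^sub>0 complex) \<Rightarrow> _"
  by standard (auto intro!: poly_mapping_eqI simp: lookup_free_scale lookup_add algebra_simps)

abbreviation free_gen :: "'x \<Rightarrow> ('x \<Rightarrow>\<^sub>0 complex)"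
  where "free_gen x \<equiv> Poly_Mapping.single x 1"

definition tensor_relations :: "('a::complex_vector \<times> 'b::complex_vector \<Rightarrow>\<^sub>0 complex) set"
  where "tensor_relations =
      {free_gen (a + a', b) - free_gen (a, b) - free_gen (a', b) | a a' b. True}
    \<union> {free_gen (a, b + b') - free_gen (a, b) - free_gen (a, b') | a b b'. True}
    \<union> {free_gen (c *\<^sub>C a, b) - free_scale c (free_gen (a, b)) | c a b. True}
    \<union> {free_gen (a, c *\<^sub>C b) - free_scale c (free_gen (a, b)) | c a b. True}"

definition tensor_eq :: "('a::complex_vector \<times> 'b::complex_vector \<Rightarrow>\<^sub>0 complex) \<Rightarrow> _ \<Rightarrow> bool"
  where "tensor_eq x y \<longleftrightarrow> x - y \<in> free.span tensor_relations"

lemma equivp_tensor_eq: "equivp tensor_eq"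
proof (rule equivpI)
  show "reflp tensor_eq" by (auto simp: reflp_def tensor_eq_def free.span_zero)
  show "symp tensor_eq"
    by (auto simp: symp_def tensor_eq_def dest: free.span_neg)
  show "transp tensor_eq"
    by (auto simp: transp_def tensor_eq_def dest: free.span_add)
qed

quotient_type (overloaded) ('a, 'b) tensor (infixr \<open>\<otimes>\<close> 70) =
  "'a::complex_vector \<times> 'b::complex_vector \<Rightarrow>\<^sub>0 complex" / tensor_eq
  by (rule equivp_tensor_eq)

instantiation tensor :: (complex_vector, complex_vector) complex_vector
begin
lift_definition zero_tensor :: "'a \<otimes> 'b" is 0 .
lift_definition plus_tensor :: "'a \<otimes> 'b \<Rightarrow> 'a \<otimes> 'b \<Rightarrow> 'a \<otimes> 'b" is "(+)"
  unfolding tensor_eq_def by (drule (1) free.span_add) (simp add: algebra_simps)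
lift_definition minus_tensor :: "'a \<otimes> 'b \<Rightarrow> 'a \<otimes> 'b \<Rightarrow> 'a \<otimes> 'b" is "(-)"
  unfolding tensor_eq_def by (drule (1) free.span_diff) (simp add: algebra_simps)
lift_definition uminus_tensor :: "'a \<otimes> 'b \<Rightarrow> 'a \<otimes> 'b" is uminus
  unfolding tensor_eq_def by (drule free.span_neg) simp
lift_definition scaleC_tensor :: "complex \<Rightarrow> 'a \<otimes> 'b \<Rightarrow> 'a \<otimes> 'b" is free_scale
  unfolding tensor_eq_def by (metis free.span_scale free.scale_right_diff_distrib)
instance
proof
  fix x y z :: "'a \<otimes> 'b" and c d :: complex
  have eq: "tensor_eq u u" for u :: "'a \<times> 'b \<Rightarrow>\<^sub>0 complex"
    using equivp_reflp[OF equivp_tensor_eq] .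
  show "x + y + z = x + (y + z)" by transfer (simp add: eq add.assoc)
  show "x + y = y + x" by transfer (simp add: eq add.commute)
  show "0 + x = x" by transfer (simp add: eq)
  show "- x + x = 0" by transfer (simp add: eq)
  show "x - y = x + - y" by transfer (simp add: eq)
  show "c *\<^sub>C (x + y) = c *\<^sub>C x + c *\<^sub>C y"
    by transfer (simp add: eq free.scale_right_distrib)
  show "(c + d) *\<^sub>C x = c *\<^sub>C x + d *\<^sub>C x"
    by transfer (simp add: eq free.scale_left_distrib)
  show "c *\<^sub>C d *\<^sub>C x = (c * d) *\<^sub>C x" by transfer (simp add: eq)
  show "1 *\<^sub>C x = x" by transfer (simp add: eq)
qed
end

lift_definition tensor :: "'a::complex_vector \<Rightarrow> 'b::complex_vector \<Rightarrow> 'a \<otimes> 'b" (infixr \<open>\<otimes>\<close> 70)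
  is "\<lambda>a b. free_gen (a, b)" .

lemma cbilinear_tensor: "cbilinear (\<otimes>)"
proof -
  have r: "x - y - z \<in> tensor_relations \<Longrightarrow> tensor_eq x (y + z)"
       "x - y \<in> tensor_relations \<Longrightarrow> tensor_eq x y"
    for x y z :: "'a \<times> 'b \<Rightarrow>\<^sub>0 complex"
    by (auto simp: tensor_eq_def diff_diff_eq intro: free.span_base)
  show ?thesis
    unfolding cbilinear_iff
    by (intro conjI allI; transfer; rule r; unfold tensor_relations_def; blast)
qed

definition free_lift ::
    "('a \<Rightarrow> 'b \<Rightarrow> 'c) \<Rightarrow> ('a::complex_vector \<times> 'b::complex_vector \<Rightarrow>\<^sub>0 complex) \<Rightarrow> 'c::complex_vector"
  where "free_lift B f =
    (\<Sum>p\<in>Poly_Mapping.keys f. Poly_Mapping.lookup f p *\<^sub>C B (fst p) (snd p))"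

text \<open>The linear map on \<open>'a \<otimes> 'b\<close> induced by a bilinear map. It evaluates at an arbitrary
  representative; for bilinear arguments this is the universal property
  (\<open>tensor_lift_tensor\<close>, \<open>clinear_tensor_lift\<close>), for others the value is meaningless.\<close>

definition tensor_lift ::
    "('a::complex_vector \<Rightarrow> 'b::complex_vector \<Rightarrow> 'c::complex_vector) \<Rightarrow> 'a \<otimes> 'b \<Rightarrow> 'c"
  where "tensor_lift B t = free_lift B (rep_tensor t)"

lemma free_lift_superset:
  assumes "finite K" "Poly_Mapping.keys f \<subseteq> K"
  shows "free_lift B f = (\<Sum>p\<in>K. Poly_Mapping.lookup f p *\<^sub>C B (fst p) (snd p))"
  unfolding free_lift_def
  by (rule sum.mono_neutral_left) (use assms in \<open>auto simp: in_keys_iff\<close>)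

lemma free_lift_add: "free_lift B (f + g) = free_lift B f + free_lift B g"
proof -
  let ?K = "Poly_Mapping.keys f \<union> Poly_Mapping.keys g"
  have "Poly_Mapping.keys (f + g) \<subseteq> ?K" by (rule Poly_Mapping.keys_add)
  then show ?thesis
    by (simp add: free_lift_superset[of ?K] lookup_add scaleC_add_left sum.distrib)
qed

lemma free_lift_scale: "free_lift B (free_scale c f) = c *\<^sub>C free_lift B f"
proof -
  have "Poly_Mapping.keys (free_scale c f) \<subseteq> Poly_Mapping.keys f"
    by (auto simp: in_keys_iff lookup_free_scale)
  then show ?thesis
    by (simp add: free_lift_superset[of "Poly_Mapping.keys f"] lookup_free_scale
        complex_vector.scale_sum_right)
qed

lemma free_lift_gen: "free_lift B (free_gen (a, b)) = B a b"
  by (simp add: free_lift_def)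

lemma free_lift_diff: "free_lift B (f - g) = free_lift B f - free_lift B g"
  by (metis free_lift_add add_diff_cancel diff_add_cancel)

lemma free_lift_span:
  assumes "cbilinear B" "f \<in> free.span tensor_relations"
  shows "free_lift B f = 0"
  using assms(2)
proof (induction rule: free.span_induct_alt)
  case base
  show ?case by (simp add: free_lift_def)
next
  case (step c x y)
  have "free_lift B x = 0"
    using step(1) assms(1)
    by (auto simp: tensor_relations_def free_lift_diff free_lift_gen free_lift_scale cbilinear_iff)
  then show ?case by (simp add: free_lift_add free_lift_scale step)
qed

lemma free_lift_cong:
  assumes "cbilinear B" "tensor_eq f g"
  shows "free_lift B f = free_lift B g"
  using free_lift_span[OF assms(1), of "f - g"] assms(2) by (simp add: tensor_eq_def free_lift_diff)

lemma tensor_lift_abs: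
  assumes "cbilinear B"
  shows "tensor_lift B (abs_tensor f) = free_lift B f"
  unfolding tensor_lift_def
  by (rule free_lift_cong[OF assms]) (metis Quotient3_abs_rep Quotient3_tensor tensor.abs_eq_iff)

lemma tensor_lift_tensor: "cbilinear B \<Longrightarrow> tensor_lift B (a \<otimes> b) = B a b"
  by (simp add: tensor.abs_eq tensor_lift_abs free_lift_gen)

lemma tensor_lift_add: "cbilinear B \<Longrightarrow> tensor_lift B (s + t) = tensor_lift B s + tensor_lift B t"
  by (induction s rule: tensor.abs_induct, induction t rule: tensor.abs_induct)
    (simp add: plus_tensor.abs_eq tensor_lift_abs free_lift_add)

lemma tensor_lift_scaleC: "cbilinear B \<Longrightarrow> tensor_lift B (c *\<^sub>C t) = c *\<^sub>C tensor_lift B t"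
  by (induction t rule: tensor.abs_induct)
    (simp add: scaleC_tensor.abs_eq tensor_lift_abs free_lift_scale)

lemma clinear_tensor_lift: "cbilinear B \<Longrightarrow> clinear (tensor_lift B)"
  by (simp add: clinear_iff tensor_lift_add tensor_lift_scaleC)

lemma tensor_lift_add_fun:
  "tensor_lift (\<lambda>a b. B a b + B' a b) t = tensor_lift B t + tensor_lift B' t"
  by (simp add: tensor_lift_def free_lift_def scaleC_add_right sum.distrib)

lemma tensor_lift_scaleC_fun: "tensor_lift (\<lambda>a b. c *\<^sub>C B a b) t = c *\<^sub>C tensor_lift B t"
  by (simp add: tensor_lift_def free_lift_def complex_vector.scale_sum_right mult.commute)

lemma tensor_add_left: "(a + a') \<otimes> b = a \<otimes> b + a' \<otimes> b"
  and tensor_add_right: "a \<otimes> (b + b') = a \<otimes> b + a \<otimes> b'"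
  and tensor_scaleC_left: "(c *\<^sub>C a) \<otimes> b = c *\<^sub>C (a \<otimes> b)"
  and tensor_scaleC_right: "a \<otimes> (c *\<^sub>C b) = c *\<^sub>C (a \<otimes> b)"
  by (simp_all add: cbilinear_tensor[unfolded cbilinear_iff])

lemma tensor_induct [case_names tensor add]:
  fixes t :: "'a::complex_vector \<otimes> 'b::complex_vector"
  assumes tens: "\<And>a b. P (a \<otimes> b)" and add: "\<And>s t. P s \<Longrightarrow> P t \<Longrightarrow> P (s + t)"
  shows "P t"
proof -
  have gen: "P (abs_tensor (Poly_Mapping.single p c))" for p :: "'a \<times> 'b" and c
  proof -
    have "Poly_Mapping.single p c = free_scale c (free_gen p)"
      by (rule poly_mapping_eqI) (simp add: lookup_free_scale lookup_single when_def)
    then have "abs_tensor (Poly_Mapping.single p c) = c *\<^sub>C (fst p \<otimes> snd p)"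
      by (simp add: tensor.abs_eq scaleC_tensor.abs_eq)
    also have "\<dots> = (c *\<^sub>C fst p) \<otimes> snd p"
      by (simp add: tensor_scaleC_left)
    finally have "abs_tensor (Poly_Mapping.single p c) = (c *\<^sub>C fst p) \<otimes> snd p" .
    then show ?thesis by (simp add: tens)
  qed
  have "P (abs_tensor (\<Sum>p\<in>K. Poly_Mapping.single p (Poly_Mapping.lookup f p)))"
    if "finite K" for f :: "'a \<times> 'b \<Rightarrow>\<^sub>0 complex" and K
    using that
  proof (induction K)
    case empty
    show ?case using gen[of undefined 0] by simp
  next
    case (insert p K)
    then show ?case by (simp add: add gen plus_tensor.abs_eq[symmetric])
  qed
  moreover have "f = (\<Sum>p\<in>Poly_Mapping.keys f. Poly_Mapping.single p (Poly_Mapping.lookup f p))"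
    for f :: "'a \<times> 'b \<Rightarrow>\<^sub>0 complex"
    by (rule poly_mapping_eqI)
      (simp add: lookup_sum lookup_single when_def sum.delta in_keys_iff)
  ultimately show ?thesis
    by (induction t rule: tensor.abs_induct) (metis finite_keys)
qed

lemma clinear_tensor_eqI:
  assumes "clinear f" "clinear g" "\<And>a b. f (a \<otimes> b) = g (a \<otimes> b)"
  shows "f t = g t"
  by (induction t rule: tensor_induct) (simp_all add: assms clinear_add)

definition tensor_map ::
    "('a::complex_vector \<Rightarrow> 'c::complex_vector) \<Rightarrow> ('b::complex_vector \<Rightarrow> 'd::complex_vector)
      \<Rightarrow> 'a \<otimes> 'b \<Rightarrow> 'c \<otimes> 'd"
  where "tensor_map f g = tensor_lift (\<lambda>a b. f a \<otimes> g b)"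

definition tensor_flip :: "'a::complex_vector \<otimes> 'b::complex_vector \<Rightarrow> 'b \<otimes> 'a"
  where "tensor_flip = tensor_lift (\<lambda>a b. b \<otimes> a)"

definition tensor_assoc ::
    "('a::complex_vector \<otimes> 'b::complex_vector) \<otimes> 'c::complex_vector \<Rightarrow> 'a \<otimes> ('b \<otimes> 'c)"
  where "tensor_assoc = tensor_lift (\<lambda>t c. tensor_lift (\<lambda>a b. a \<otimes> (b \<otimes> c)) t)"

text \<open>For antilinear \<open>f\<close> and \<open>g\<close>, the antilinear map \<open>a \<otimes> b \<mapsto> f a \<otimes> g b\<close>, obtained from a
  linear map into the conjugate space.\<close>

definition antilinear_tensor_map ::
    "('a::complex_vector \<Rightarrow> 'c::complex_vector) \<Rightarrow> ('b::complex_vector \<Rightarrow> 'd::complex_vector)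
      \<Rightarrow> 'a \<otimes> 'b \<Rightarrow> 'c \<otimes> 'd"
  where "antilinear_tensor_map f g t = unbar (tensor_lift (\<lambda>a b. bar (f a \<otimes> g b)) t)"

lemma tensor_map_tensor:
  "clinear f \<Longrightarrow> clinear g \<Longrightarrow> tensor_map f g (a \<otimes> b) = f a \<otimes> g b"
  unfolding tensor_map_def
  by (rule tensor_lift_tensor)
    (simp add: cbilinear_iff clinear_iff tensor_add_left tensor_add_right
      tensor_scaleC_left tensor_scaleC_right)

lemma tensor_flip_tensor: "tensor_flip (a \<otimes> b) = b \<otimes> a"
  unfolding tensor_flip_def
  by (rule tensor_lift_tensor)
    (simp add: cbilinear_iff tensor_add_left tensor_add_right
      tensor_scaleC_left tensor_scaleC_right)

lemma tensor_assoc_tensor: "tensor_assoc ((a \<otimes> b) \<otimes> c) = a \<otimes> (b \<otimes> c)"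
proof -
  have 1: "cbilinear (\<lambda>a b. a \<otimes> (b \<otimes> c))" for c :: 'c
    by (simp add: cbilinear_iff tensor_add_left tensor_add_right
        tensor_scaleC_left tensor_scaleC_right)
  have 2: "cbilinear (\<lambda>t c. tensor_lift (\<lambda>(a::'a) (b::'b). a \<otimes> (b \<otimes> (c::'c))) t)"
    unfolding cbilinear_iff
    by (simp add: tensor_lift_add tensor_lift_scaleC 1 tensor_add_right tensor_scaleC_right
        tensor_lift_add_fun tensor_lift_scaleC_fun)
  show ?thesis
    by (simp add: tensor_assoc_def tensor_lift_tensor[OF 2] tensor_lift_tensor[OF 1])
qed

lemma antilinear_tensor_map_tensor:
  assumes "\<And>x y. f (x + y) = f x + f y" "\<And>c x. f (c *\<^sub>C x) = cnj c *\<^sub>C f x"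
    and "\<And>x y. g (x + y) = g x + g y" "\<And>c x. g (c *\<^sub>C x) = cnj c *\<^sub>C g x"
  shows "antilinear_tensor_map f g (a \<otimes> b) = f a \<otimes> g b"
proof -
  have "cbilinear (\<lambda>a b. bar (f a \<otimes> g b))"
    by (simp add: cbilinear_iff assms tensor_add_left tensor_add_right
      tensor_scaleC_left tensor_scaleC_right bar_add bar_scaleC)
  then show ?thesis by (simp add: antilinear_tensor_map_def tensor_lift_tensor)
qed


subsection \<open>The tensor product algebra\<close>

lemma cbilinear_times_inner:
  fixes a :: "'a::complex_algebra_1" and b :: "'b::complex_algebra_1"
  shows "cbilinear (\<lambda>c d. (a * c) \<otimes> (b * d))"
  by (simp add: cbilinear_iff distrib_left scaleC_mult_right tensor_add_left tensor_add_right
      tensor_scaleC_left tensor_scaleC_right)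

lemma cbilinear_times_outer:
  fixes y :: "'a::complex_algebra_1 \<otimes> 'b::complex_algebra_1"
  shows "cbilinear (\<lambda>a b. tensor_lift (\<lambda>c d. (a * c) \<otimes> (b * d)) y)"
  unfolding cbilinear_iff
  by (simp add: distrib_right scaleC_mult_left tensor_add_left tensor_add_right
      tensor_scaleC_left tensor_scaleC_right tensor_lift_add_fun tensor_lift_scaleC_fun)

instantiation tensor :: (complex_algebra_1, complex_algebra_1) complex_algebra_1
begin

definition one_tensor_def: "1 = 1 \<otimes> 1"

definition times_tensor_def:
  "x * y = tensor_lift (\<lambda>a b. tensor_lift (\<lambda>c d. (a * c) \<otimes> (b * d)) y) x"

instance
proof
  note 1 = cbilinear_times_inner and 2 = cbilinear_times_outer
  have pure: "(a \<otimes> b) * (c \<otimes> d) = (a * c) \<otimes> (b * d)" for a c :: 'a and b d :: 'b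
    unfolding times_tensor_def by (subst tensor_lift_tensor[OF 2]) (rule tensor_lift_tensor[OF 1])
  have pl: "(a \<otimes> b) * y = tensor_lift (\<lambda>c d. (a * c) \<otimes> (b * d)) y"
    for a :: 'a and b :: 'b and y :: "'a \<otimes> 'b"
    unfolding times_tensor_def by (rule tensor_lift_tensor[OF 2])
  have dr: "(x + y) * z = x * z + y * z" for x y z :: "'a \<otimes> 'b"
    by (simp add: times_tensor_def tensor_lift_add 2)
  have sl: "(k *\<^sub>C x) * y = k *\<^sub>C (x * y)" for k and x y :: "'a \<otimes> 'b"
    by (simp add: times_tensor_def tensor_lift_scaleC 2)
  have dl': "(a \<otimes> b) * (y + z) = (a \<otimes> b) * y + (a \<otimes> b) * z"
    for a :: 'a and b :: 'b and y z :: "'a \<otimes> 'b"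
    by (simp add: pl tensor_lift_add 1)
  have dl: "x * (y + z) = x * y + x * z" for x y z :: "'a \<otimes> 'b"
    by (induction x rule: tensor_induct) (simp_all add: dr dl')
  have sr': "(a \<otimes> b) * (k *\<^sub>C y) = k *\<^sub>C ((a \<otimes> b) * y)"
    for k and a :: 'a and b :: 'b and y :: "'a \<otimes> 'b"
    by (simp add: pl tensor_lift_scaleC 1)
  have sr: "x * (k *\<^sub>C y) = k *\<^sub>C (x * y)" for k and x y :: "'a \<otimes> 'b"
    by (induction x rule: tensor_induct) (simp_all add: dr sr' scaleC_add_right)
  have as1: "(a \<otimes> b) * (c \<otimes> d) * z = (a \<otimes> b) * ((c \<otimes> d) * z)"
    for a c :: 'a and b d :: 'b and z :: "'a \<otimes> 'b"
    by (induction z rule: tensor_induct) (simp_all add: pure dl mult.assoc)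
  have as2: "(a \<otimes> b) * y * z = (a \<otimes> b) * (y * z)"
    for a :: 'a and b :: 'b and y z :: "'a \<otimes> 'b"
    by (induction y rule: tensor_induct) (simp_all add: as1 dl dr)
  fix x y z :: "'a \<otimes> 'b" and k :: complex
  show "x * y * z = x * (y * z)"
    by (induction x rule: tensor_induct) (simp_all add: as2 dr)
  show "1 * x = x"
    by (induction x rule: tensor_induct) (simp_all add: one_tensor_def pure dl)
  show "x * 1 = x"
    by (induction x rule: tensor_induct) (simp_all add: one_tensor_def pure dr)
  show "(x + y) * z = x * z + y * z" by (rule dr)
  show "x * (y + z) = x * y + x * z" by (rule dl)
  show "(k *\<^sub>C x) * y = k *\<^sub>C (x * y)" by (rule sl)
  show "x * (k *\<^sub>C y) = k *\<^sub>C (x * y)" by (rule sr)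
qed

end

lemma tensor_times_tensor: "(a \<otimes> b) * (c \<otimes> d) = (a * c) \<otimes> (b * d)"
  unfolding times_tensor_def
  by (subst tensor_lift_tensor[OF cbilinear_times_outer])
    (rule tensor_lift_tensor[OF cbilinear_times_inner])

definition leg12 :: "'h \<otimes> 'h \<Rightarrow> ('h::complex_algebra_1 \<otimes> 'h) \<otimes> 'h"
  where "leg12 = tensor_lift (\<lambda>a b. (a \<otimes> b) \<otimes> 1)"

definition leg13 :: "'h \<otimes> 'h \<Rightarrow> ('h::complex_algebra_1 \<otimes> 'h) \<otimes> 'h"
  where "leg13 = tensor_lift (\<lambda>a b. (a \<otimes> 1) \<otimes> b)"

definition leg23 :: "'h \<otimes> 'h \<Rightarrow> ('h::complex_algebra_1 \<otimes> 'h) \<otimes> 'h"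
  where "leg23 = tensor_lift (\<lambda>a b. (1 \<otimes> a) \<otimes> b)"

lemma leg12_tensor: "leg12 (a \<otimes> b) = (a \<otimes> b) \<otimes> 1"
  and leg13_tensor: "leg13 (a \<otimes> b) = (a \<otimes> 1) \<otimes> b"
  and leg23_tensor: "leg23 (a \<otimes> b) = (1 \<otimes> a) \<otimes> b"
  unfolding leg12_def leg13_def leg23_def
  by (rule tensor_lift_tensor;
      simp add: cbilinear_iff tensor_add_left tensor_add_right
        tensor_scaleC_left tensor_scaleC_right)+


section \<open>Quasitriangular Hopf *-algebras\<close>

text \<open>Sweedler sums: \<open>tensor_lift (\<lambda>b c. F b c) (\<Delta> a)\<close> is \<open>F(a\<^sub>1, a\<^sub>2)\<close> for bilinear \<open>F\<close>.\<close>

locale hopf_algebra =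
  fixes \<Delta> :: "'h::complex_algebra_1 \<Rightarrow> 'h \<otimes> 'h"
    and \<epsilon> :: "'h \<Rightarrow> complex"
    and S :: "'h \<Rightarrow> 'h"
  assumes linear_coproduct: "clinear \<Delta>"
    and coproduct_mult: "\<Delta> (a * b) = \<Delta> a * \<Delta> b"
    and coproduct_one: "\<Delta> 1 = 1"
    and linear_counit: "clinear \<epsilon>"
    and counit_mult: "\<epsilon> (a * b) = \<epsilon> a * \<epsilon> b"
    and counit_one: "\<epsilon> 1 = 1"
    and coassoc: "tensor_assoc (tensor_map \<Delta> id (\<Delta> a)) = tensor_map id \<Delta> (\<Delta> a)"
    and counit_left: "tensor_lift (\<lambda>b c. \<epsilon> b *\<^sub>C c) (\<Delta> a) = a"
    and counit_right: "tensor_lift (\<lambda>b c. \<epsilon> c *\<^sub>C b) (\<Delta> a) = a"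
    and linear_antipode: "clinear S"
    and antipode_left: "tensor_lift (\<lambda>b c. S b * c) (\<Delta> a) = \<epsilon> a *\<^sub>C 1"
    and antipode_right: "tensor_lift (\<lambda>b c. b * S c) (\<Delta> a) = \<epsilon> a *\<^sub>C 1"

locale hopf_star_algebra = hopf_algebra \<Delta> \<epsilon> S
  for \<Delta> :: "'h::complex_algebra_1 \<Rightarrow> 'h \<otimes> 'h" and \<epsilon> S +
  fixes star :: "'h \<Rightarrow> 'h"
  assumes star_add: "star (a + b) = star a + star b"
    and star_scaleC: "star (c *\<^sub>C a) = cnj c *\<^sub>C star a"
    and star_star: "star (star a) = a"
    and star_mult: "star (a * b) = star b * star a"
    and coproduct_star: "\<Delta> (star a) = antilinear_tensor_map star star (\<Delta> a)"

text \<open>The threefold tensor power is bracketed as \<open>('h \<otimes> 'h) \<otimes> 'h\<close> for the legs of \<open>R\<close>; identities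
  naturally living in \<open>'h \<otimes> ('h \<otimes> 'h)\<close> are compared through \<open>tensor_assoc\<close>.\<close>

locale quasitriangular_hopf_star_algebra = hopf_star_algebra \<Delta> \<epsilon> S star
  for \<Delta> :: "'h::complex_algebra_1 \<Rightarrow> 'h \<otimes> 'h" and \<epsilon> S star +
  fixes R :: "'h \<otimes> 'h"
  assumes R_invertible_intertwines:
      "\<exists>R'. R * R' = 1 \<and> R' * R = 1 \<and> (\<forall>a. R * \<Delta> a * R' = tensor_flip (\<Delta> a))"
    and coproduct_id_R: "tensor_map \<Delta> id R = leg13 R * leg23 R"
    and id_coproduct_R: "tensor_map id \<Delta> R = tensor_assoc (leg13 R * leg12 R)"

definition real_R_matrix :: "('h \<Rightarrow> 'h) \<Rightarrow> 'h::complex_algebra_1 \<otimes> 'h \<Rightarrow> bool"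
  where "real_R_matrix star R \<longleftrightarrow> antilinear_tensor_map star star R = tensor_flip R"


section \<open>Modules, braiding and *-modules\<close>

definition left_module :: "('h::complex_algebra_1 \<Rightarrow> 'v::complex_vector \<Rightarrow> 'v) \<Rightarrow> bool"
  where "left_module act \<longleftrightarrow>
    cbilinear act \<and> (\<forall>v. act 1 v = v) \<and> (\<forall>a b v. act (a * b) v = act a (act b v))"

definition module_map ::
    "('h \<Rightarrow> 'v \<Rightarrow> 'v) \<Rightarrow> ('h \<Rightarrow> 'w \<Rightarrow> 'w) \<Rightarrow> ('v::complex_vector \<Rightarrow> 'w::complex_vector) \<Rightarrow> bool"
  where "module_map actV actW T \<longleftrightarrow> clinear T \<and> (\<forall>a v. T (actV a v) = actW a (T v))"

text \<open>The coordinate-wise action of \<open>H \<otimes> H\<close> on \<open>U \<otimes> V\<close>.\<close>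

definition act2 ::
    "('h \<Rightarrow> 'u \<Rightarrow> 'u) \<Rightarrow> ('h \<Rightarrow> 'v \<Rightarrow> 'v) \<Rightarrow> 'h::complex_algebra_1 \<otimes> 'h
      \<Rightarrow> 'u::complex_vector \<otimes> 'v::complex_vector \<Rightarrow> 'u \<otimes> 'v"
  where "act2 actU actV x t = tensor_lift (\<lambda>a b. tensor_map (actU a) (actV b) t) x"

definition tensor_act ::
    "('h \<Rightarrow> 'h \<otimes> 'h) \<Rightarrow> ('h \<Rightarrow> 'u \<Rightarrow> 'u) \<Rightarrow> ('h \<Rightarrow> 'v \<Rightarrow> 'v) \<Rightarrow> 'h::complex_algebra_1
      \<Rightarrow> 'u::complex_vector \<otimes> 'v::complex_vector \<Rightarrow> 'u \<otimes> 'v"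
  where "tensor_act \<Delta> actU actV a = act2 actU actV (\<Delta> a)"

definition braiding ::
    "'h \<otimes> 'h \<Rightarrow> ('h \<Rightarrow> 'u \<Rightarrow> 'u) \<Rightarrow> ('h::complex_algebra_1 \<Rightarrow> 'v \<Rightarrow> 'v)
      \<Rightarrow> 'u::complex_vector \<otimes> 'v::complex_vector \<Rightarrow> 'v \<otimes> 'u"
  where "braiding R actU actV = tensor_flip \<circ> act2 actU actV R"

definition conj_act ::
    "('h \<Rightarrow> 'h) \<Rightarrow> ('h \<Rightarrow> 'h) \<Rightarrow> ('h \<Rightarrow> 'v \<Rightarrow> 'v) \<Rightarrow> 'h \<Rightarrow> 'v conj_space \<Rightarrow> 'v conj_space"
  where "conj_act S star act a x = bar (act (star (S a)) (unbar x))"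

definition star_module ::
    "('h \<Rightarrow> 'h) \<Rightarrow> ('h \<Rightarrow> 'h) \<Rightarrow> ('h::complex_algebra_1 \<Rightarrow> 'v \<Rightarrow> 'v)
      \<Rightarrow> ('v::complex_vector conj_space \<Rightarrow> 'v) \<Rightarrow> bool"
  where "star_module S star act st \<longleftrightarrow>
    left_module act \<and> module_map (conj_act S star act) act st \<and> st \<circ> conj_map st = double_conj"

definition star_module_morphism ::
    "('h \<Rightarrow> 'h) \<Rightarrow> ('h \<Rightarrow> 'h)
      \<Rightarrow> ('h::complex_algebra_1 \<Rightarrow> 'v \<Rightarrow> 'v) \<Rightarrow> ('v::complex_vector conj_space \<Rightarrow> 'v)
      \<Rightarrow> ('h \<Rightarrow> 'w \<Rightarrow> 'w) \<Rightarrow> ('w::complex_vector conj_space \<Rightarrow> 'w) \<Rightarrow> ('v \<Rightarrow> 'w) \<Rightarrow> bool"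
  where "star_module_morphism S star actV stV actW stW T \<longleftrightarrow>
    star_module S star actV stV \<and> star_module S star actW stW \<and>
    module_map actV actW T \<and> T \<circ> stV = stW \<circ> conj_map T"

text \<open>The map \<open>bar (u \<otimes> v) \<mapsto> st (bar v) \<otimes> st (bar u)\<close>. As a function of \<open>u \<otimes> v\<close> it is antilinear,
  hence the detour through the conjugate space.\<close>

definition tensor_st ::
    "('v conj_space \<Rightarrow> 'v) \<Rightarrow> ('v::complex_vector \<otimes> 'v) conj_space \<Rightarrow> 'v \<otimes> 'v"
  where "tensor_st st x = unbar (tensor_lift (\<lambda>u v. bar (st (bar v) \<otimes> st (bar u))) (unbar x))"

lemma tensor_st_tensor:
  assumes "clinear st"
  shows "tensor_st st (bar (u \<otimes> v)) = st (bar v) \<otimes> st (bar u)"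
    and "clinear (tensor_st st)"
proof -
  have B: "cbilinear (\<lambda>u v. bar (st (bar v) \<otimes> st (bar u)))"
    by (simp add: cbilinear_iff bar_add bar_scaleC clinear_add[OF assms] clinear_scaleC[OF assms]
        tensor_add_left tensor_add_right tensor_scaleC_left tensor_scaleC_right)
  show "tensor_st st (bar (u \<otimes> v)) = st (bar v) \<otimes> st (bar u)"
    by (simp add: tensor_st_def tensor_lift_tensor[OF B])
  show "clinear (tensor_st st)"
    by (simp add: clinear_iff tensor_st_def unbar_add unbar_scaleC tensor_lift_add[OF B]
        tensor_lift_scaleC[OF B])
qed

lemma act2_tensor:
  assumes "cbilinear actU" "cbilinear actV"
  shows "act2 actU actV (a \<otimes> b) (u \<otimes> v) = actU a u \<otimes> actV b v"
proof -
  have l: "clinear (actU a)" "clinear (actV b)" for a b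
    using assms by (auto simp: cbilinear_def)
  have eq: "tensor_map (actU a) (actV b) (u \<otimes> v) = actU a u \<otimes> actV b v" for a b
    by (rule tensor_map_tensor[OF l])
  have "cbilinear (\<lambda>a b. actU a u \<otimes> actV b v)"
    using assms by (simp add: cbilinear_iff tensor_add_left tensor_add_right
        tensor_scaleC_left tensor_scaleC_right)
  then show ?thesis by (simp add: act2_def eq tensor_lift_tensor)
qed

end

theory Submission
  imports Defs
begin

text \<open>
  Write \<open>J v\<close> for \<open>st (bar v)\<close>, an antilinear involution of the module, and \<open>a\<^sup>*\<close> for
  \<open>star a\<close>. That \<open>st\<close> is a module map says \<open>J (S(a)\<^sup>* v) = a (J v)\<close>, and as \<open>J\<close> is an
  involution this is the same as \<open>J (a v) = S(a)\<^sup>* (J v)\<close>. On the tensor square the involution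
  \<open>J\<^sub>2 (u \<otimes> v) = J v \<otimes> J u\<close> reverses the factors, hence for \<open>x\<close> in \<open>H \<otimes> H\<close>
  \<open>J\<^sub>2 (x t) = \<tau>((* \<otimes> *)((S \<otimes> S) x)) (J\<^sub>2 t)\<close>, where \<open>\<tau>\<close> is the flip (\<open>tensor_st_act2\<close>).
  Both halves of the theorem are instances of this formula.

  For \<open>x = R\<close>, the identity \<open>(S \<otimes> S) R = R\<close> (\<open>antipode_R\<close>) and reality,
  \<open>(* \<otimes> *) R = \<tau> R\<close>, give \<open>J\<^sub>2 (R t) = R (J\<^sub>2 t)\<close>. As \<open>J\<^sub>2\<close> also commutes with the flip, it
  commutes with the braiding.

  For \<open>x = \<Delta> a\<close>, the antipode being an anti-homomorphism of coalgebras, \<open>\<Delta> (S a) = \<tau>((S \<otimes> S)(\<Delta> a))\<close>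
  (\<open>coproduct_antipode\<close>), gives \<open>J\<^sub>2 (a t) = S(a)\<^sup>* (J\<^sub>2 t)\<close>, so that the tensor square is again a
  \<open>*\<close>-module. The braiding is a module map because \<open>R (\<Delta> a) = \<tau>(\<Delta> a) R\<close>.

  The two facts on the antipode come from the convolution product of linear maps on \<open>H\<close>. First,
  \<open>\<Delta> \<circ> S\<close> and \<open>\<tau> \<circ> (S \<otimes> S) \<circ> \<Delta>\<close> are a left and a right convolution inverse of \<open>\<Delta>\<close>, hence
  equal. Second, the hexagon identity for \<open>(\<Delta> \<otimes> id) R\<close> makes \<open>f \<mapsto> (f \<otimes> id) R\<close> multiplicative
  from the convolution algebra to \<open>H \<otimes> H\<close>, so that \<open>(S \<otimes> id) R\<close> is the inverse \<open>Q\<close> of \<open>R\<close>.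
  Inverting the other hexagon identity gives one for \<open>Q\<close>, and the same argument on the second leg
  yields \<open>(id \<otimes> S) Q = R\<close>.
\<close>


section \<open>One-sided inverses\<close>

lemma left_neutral_of_right_invertible:
  fixes x :: "'a::monoid_mult"
  assumes "e * x = x" "x * y = 1"
  shows "e = 1"
proof -
  have "e = e * x * y"
    by (simp add: mult.assoc assms(2))
  then show ?thesis
    by (simp add: assms)
qed

lemma left_inverse_eq_right_inverse:
  fixes x :: "'a::monoid_mult"
  assumes "z * x = 1" "x * y = 1"
  shows "z = y"
proof -
  have "z = z * x * y"
    by (simp add: mult.assoc assms(2))
  then show ?thesis
    by (simp add: assms(1))
qed


section \<open>Multilinear maps out of tensor products\<close>

lemma cbilinear_add_left: "cbilinear B \<Longrightarrow> B (a + a') b = B a b + B a' b"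
  and cbilinear_add_right: "cbilinear B \<Longrightarrow> B a (b + b') = B a b + B a b'"
  and cbilinear_scaleC_left: "cbilinear B \<Longrightarrow> B (c *\<^sub>C a) b = c *\<^sub>C B a b"
  and cbilinear_scaleC_right: "cbilinear B \<Longrightarrow> B a (c *\<^sub>C b) = c *\<^sub>C B a b"
  by (simp_all add: cbilinear_iff)

lemma clinear_tensor_map: "clinear f \<Longrightarrow> clinear g \<Longrightarrow> clinear (tensor_map f g)"
  unfolding tensor_map_def
  by (rule clinear_tensor_lift)
    (simp add: cbilinear_iff clinear_add clinear_scaleC tensor_add_left tensor_add_right
      tensor_scaleC_left tensor_scaleC_right)

lemma clinear_tensor_flip: "clinear tensor_flip"
  unfolding tensor_flip_def
  by (rule clinear_tensor_lift)
    (simp add: cbilinear_iff tensor_add_left tensor_add_right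
      tensor_scaleC_left tensor_scaleC_right)

lemma clinear_tensor_assoc:
  "clinear (tensor_assoc :: ('a::complex_vector \<otimes> 'b::complex_vector) \<otimes> 'c::complex_vector \<Rightarrow> _)"
proof -
  have inner: "cbilinear (\<lambda>(a::'a) (b::'b). a \<otimes> (b \<otimes> c))" for c :: 'c
    by (simp add: cbilinear_iff tensor_add_left tensor_add_right
        tensor_scaleC_left tensor_scaleC_right)
  show ?thesis
    unfolding tensor_assoc_def
    by (rule clinear_tensor_lift, unfold cbilinear_iff)
      (simp add: tensor_lift_add tensor_lift_scaleC inner tensor_add_right
        tensor_scaleC_right tensor_lift_add_fun tensor_lift_scaleC_fun)
qed

lemma clinear_leg12: "clinear leg12" and clinear_leg13: "clinear leg13"
  and clinear_leg23: "clinear leg23"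
  unfolding leg12_def leg13_def leg23_def
  by (rule clinear_tensor_lift;
      simp add: cbilinear_iff tensor_add_left tensor_add_right
        tensor_scaleC_left tensor_scaleC_right)+

lemma clinear_id: "clinear id" and clinear_ident: "clinear (\<lambda>x. x)"
  by (simp_all add: clinear_iff)

lemmas multilinear_simps =
  tensor_add_left tensor_add_right tensor_scaleC_left tensor_scaleC_right
  distrib_left distrib_right scaleC_mult_left scaleC_mult_right
  scaleC_add_left scaleC_add_right tensor_lift_add_fun tensor_lift_scaleC_fun
  clinear_tensor_map[THEN clinear_add] clinear_tensor_map[THEN clinear_scaleC]
  clinear_tensor_flip[THEN clinear_add] clinear_tensor_flip[THEN clinear_scaleC]
  clinear_tensor_assoc[THEN clinear_add] clinear_tensor_assoc[THEN clinear_scaleC]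
  clinear_leg12[THEN clinear_add] clinear_leg13[THEN clinear_add] clinear_leg23[THEN clinear_add]
  clinear_id clinear_ident

text \<open>For every \<open>F\<close>, bilinear or not, \<^const>\<open>tensor_lift\<close> is a finite linear combination of values
  of \<open>F\<close>, which \<open>G\<close> preserves.\<close>

lemma clinear_commute_tensor_lift:
  fixes G :: "'c::complex_vector \<Rightarrow> 'd::complex_vector"
  assumes "clinear G"
  shows "G (tensor_lift F t) = tensor_lift (\<lambda>a b. G (F a b)) t"
proof -
  have sum: "G (\<Sum>x\<in>A. f x) = (\<Sum>x\<in>A. G (f x))" for f :: "'x \<Rightarrow> 'c" and A
    using assms by (induction A rule: infinite_finite_induct) (auto simp: clinear_add clinear_zero)
  show ?thesis
    by (simp add: tensor_lift_def free_lift_def sum clinear_scaleC[OF assms])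
qed

lemma tensor_lift_tensor_map:
  assumes "cbilinear F" "clinear f" "clinear g"
  shows "tensor_lift F (tensor_map f g t) = tensor_lift (\<lambda>a b. F (f a) (g b)) t"
  unfolding tensor_map_def
  by (subst clinear_commute_tensor_lift[OF clinear_tensor_lift[OF assms(1)]])
    (simp add: tensor_lift_tensor assms(1))

lemma tensor_map_compose:
  assumes "clinear f" "clinear g" "clinear f'" "clinear g'"
  shows "tensor_map f g (tensor_map f' g' t) = tensor_map (\<lambda>a. f (f' a)) (\<lambda>b. g (g' b)) t"
proof -
  have "cbilinear (\<lambda>a b. f a \<otimes> g b)"
    by (simp add: cbilinear_iff multilinear_simps assms[THEN clinear_add] assms[THEN clinear_scaleC])
  from tensor_lift_tensor_map[OF this assms(3,4)] show ?thesis
    by (simp add: tensor_map_def)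
qed

lemma tensor_map_id: "tensor_map (\<lambda>x. x) (\<lambda>x. x) t = t"
  by (induction t rule: tensor_induct) (simp_all add: tensor_map_tensor multilinear_simps)

lemma tensor_flip_flip: "tensor_flip (tensor_flip t) = t"
  by (induction t rule: tensor_induct) (simp_all add: tensor_flip_tensor multilinear_simps)

text \<open>A trilinear map induces a linear map on either bracketing of the threefold tensor power, as an
  iterated \<^const>\<open>tensor_lift\<close>; evaluating these maps turns identities between threefold tensors
  into identities between iterated Sweedler sums.\<close>

definition ctrilinear ::
    "('a::complex_vector \<Rightarrow> 'b::complex_vector \<Rightarrow> 'c::complex_vector \<Rightarrow> 'd::complex_vector) \<Rightarrow> bool"
  where "ctrilinear T \<longleftrightarrow> (\<forall>a. cbilinear (T a)) \<and> (\<forall>b. cbilinear (\<lambda>a. T a b))"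

lemma ctrilinear_first_two: "ctrilinear T \<Longrightarrow> cbilinear (\<lambda>a b. T a b c)"
  by (simp add: ctrilinear_def cbilinear_iff)

lemma cbilinear_lift_left:
  assumes "ctrilinear T"
  shows "cbilinear (\<lambda>t c. tensor_lift (\<lambda>a b. T a b c) t)"
proof -
  have "cbilinear (\<lambda>a b. T a b c)" for c
    using assms by (rule ctrilinear_first_two)
  then show ?thesis
    using assms
    by (simp add: ctrilinear_def cbilinear_iff tensor_lift_add tensor_lift_scaleC
        tensor_lift_add_fun[symmetric] tensor_lift_scaleC_fun[symmetric])
qed

lemma cbilinear_lift_right:
  assumes "ctrilinear T"
  shows "cbilinear (\<lambda>a t. tensor_lift (T a) t)"
proof -
  have "cbilinear (T a)" for a
    using assms by (simp add: ctrilinear_def)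
  moreover have "T (a + a') = (\<lambda>b c. T a b c + T a' b c)"
      "T (k *\<^sub>C a) = (\<lambda>b c. k *\<^sub>C T a b c)" for a a' k
    using assms by (simp_all add: fun_eq_iff ctrilinear_def cbilinear_iff)
  ultimately show ?thesis
    by (simp add: cbilinear_iff[of "\<lambda>a. tensor_lift (T a)"] tensor_lift_add tensor_lift_scaleC
        tensor_lift_add_fun tensor_lift_scaleC_fun)
qed

lemma tensor_lift_tensor_assoc:
  assumes T: "ctrilinear T"
  shows "tensor_lift (\<lambda>a. tensor_lift (T a)) (tensor_assoc s)
    = tensor_lift (\<lambda>t c. tensor_lift (\<lambda>a b. T a b c) t) s"
proof (induction s rule: tensor_induct)
  case (tensor t c)
  have B: "cbilinear (T a)" "cbilinear (\<lambda>a b. T a b c)" for a c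
    using T ctrilinear_first_two[OF T] by (simp_all add: ctrilinear_def)
  note L = cbilinear_lift_left[OF T] cbilinear_lift_right[OF T]
  show ?case
    by (induction t rule: tensor_induct)
      (simp_all add: tensor_assoc_tensor tensor_lift_tensor tensor_lift_add B L multilinear_simps)
qed (simp add: tensor_lift_add cbilinear_lift_left[OF T] cbilinear_lift_right[OF T]
      multilinear_simps)

lemma tensor_map_mult:
  assumes "clinear f" "clinear g" "\<And>a b. f (a * b) = f a * f b" "\<And>a b. g (a * b) = g a * g b"
  shows "tensor_map f g (x * y) = tensor_map f g x * tensor_map f g y"
proof (induction x rule: tensor_induct)
  case (tensor a b)
  show ?case
    by (induction y rule: tensor_induct)
      (simp_all add: tensor_times_tensor tensor_map_tensor assms multilinear_simps)
qed (simp add: assms multilinear_simps)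

lemma leg12_mult: "leg12 (x * y) = leg12 x * leg12 y"
proof (induction x rule: tensor_induct)
  case (tensor a b)
  show ?case
    by (induction y rule: tensor_induct)
      (simp_all add: tensor_times_tensor leg12_tensor multilinear_simps)
qed (simp add: multilinear_simps)

lemma leg13_mult: "leg13 (x * y) = leg13 x * leg13 y"
proof (induction x rule: tensor_induct)
  case (tensor a b)
  show ?case
    by (induction y rule: tensor_induct)
      (simp_all add: tensor_times_tensor leg13_tensor multilinear_simps)
qed (simp add: multilinear_simps)

lemma tensor_assoc_mult: "tensor_assoc (x * y) = tensor_assoc x * tensor_assoc y"
proof (induction x rule: tensor_induct)
  case (tensor s c)
  show ?case
  proof (induction s rule: tensor_induct)
    case (tensor a b)
    show ?case
    proof (induction y rule: tensor_induct)
      case (tensor t c')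
      show ?case
        by (induction t rule: tensor_induct)
          (simp_all add: tensor_times_tensor tensor_assoc_tensor multilinear_simps)
    qed (simp add: multilinear_simps)
  qed (simp add: multilinear_simps)
qed (simp add: multilinear_simps)


section \<open>Convolution and the antipode\<close>

context hopf_algebra
begin

definition convolution :: "('h \<Rightarrow> 'a::complex_algebra_1) \<Rightarrow> ('h \<Rightarrow> 'a) \<Rightarrow> 'h \<Rightarrow> 'a"
  where "convolution f g a = tensor_lift (\<lambda>b c. f b * g c) (\<Delta> a)"

definition convolution_unit :: "'h \<Rightarrow> 'a::complex_algebra_1"
  where "convolution_unit a = \<epsilon> a *\<^sub>C 1"

lemma counit_add: "\<epsilon> (a + b) = \<epsilon> a + \<epsilon> b"
  and counit_scaleC: "\<epsilon> (c *\<^sub>C a) = c * \<epsilon> a"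
  using linear_counit by (simp_all add: clinear_iff scaleC_complex_def)

lemma clinear_convolution_unit: "clinear convolution_unit"
  by (simp add: clinear_iff convolution_unit_def counit_add counit_scaleC scaleC_add_left)

text \<open>Coassociativity as it is used in Sweedler notation: \<open>T(a\<^sub>1\<^sub>1, a\<^sub>1\<^sub>2, a\<^sub>2) = T(a\<^sub>1, a\<^sub>2\<^sub>1, a\<^sub>2\<^sub>2)\<close>.\<close>

lemma coassoc_lift:
  assumes T: "ctrilinear T"
  shows "tensor_lift (\<lambda>x c. tensor_lift (\<lambda>a b. T a b c) (\<Delta> x)) (\<Delta> h)
    = tensor_lift (\<lambda>a x. tensor_lift (T a) (\<Delta> x)) (\<Delta> h)"
proof -
  have "tensor_lift (\<lambda>x c. tensor_lift (\<lambda>a b. T a b c) (\<Delta> x)) (\<Delta> h)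
    = tensor_lift (\<lambda>t c. tensor_lift (\<lambda>a b. T a b c) t) (tensor_map \<Delta> id (\<Delta> h))"
    by (subst tensor_lift_tensor_map)
      (simp_all add: cbilinear_lift_left[OF T] linear_coproduct clinear_id)
  also have "\<dots> = tensor_lift (\<lambda>a. tensor_lift (T a)) (tensor_map id \<Delta> (\<Delta> h))"
    by (simp add: tensor_lift_tensor_assoc[OF T, symmetric] coassoc)
  also have "\<dots> = tensor_lift (\<lambda>a x. tensor_lift (T a) (\<Delta> x)) (\<Delta> h)"
    by (subst tensor_lift_tensor_map)
      (simp_all add: cbilinear_lift_right[OF T] linear_coproduct clinear_id)
  finally show ?thesis .
qed

lemma convolution_assoc:
  assumes "clinear f" "clinear g" "clinear k"
  shows "convolution (convolution f g) k = convolution f (convolution g k)"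
proof
  fix h
  have mult_lift: "tensor_lift F t * z = tensor_lift (\<lambda>a b. F a b * z) t"
      "z * tensor_lift F t = tensor_lift (\<lambda>a b. z * F a b) t"
    for F :: "'h \<Rightarrow> 'h \<Rightarrow> 'a" and t z
    using clinear_commute_tensor_lift[of "\<lambda>w. w * z" F t]
      clinear_commute_tensor_lift[of "\<lambda>w. z * w" F t]
    by (simp_all add: clinear_iff multilinear_simps)
  have "ctrilinear (\<lambda>a b c. f a * (g b * k c))"
    by (simp add: ctrilinear_def cbilinear_iff multilinear_simps
        assms[THEN clinear_add] assms[THEN clinear_scaleC])
  from coassoc_lift[OF this, of h]
  show "convolution (convolution f g) k h = convolution f (convolution g k) h"
    by (simp add: convolution_def mult_lift mult.assoc)
qed

lemma convolution_unit_left: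
  assumes "clinear f"
  shows "convolution convolution_unit f = f"
proof
  fix a
  have "convolution convolution_unit f a = f (tensor_lift (\<lambda>b c. \<epsilon> b *\<^sub>C c) (\<Delta> a))"
    by (simp add: clinear_commute_tensor_lift[OF assms] convolution_def convolution_unit_def
        clinear_scaleC[OF assms] scaleC_mult_left)
  then show "convolution convolution_unit f a = f a"
    by (simp add: counit_left)
qed

lemma convolution_unit_right:
  assumes "clinear f"
  shows "convolution f convolution_unit = f"
proof
  fix a
  have "convolution f convolution_unit a = f (tensor_lift (\<lambda>b c. \<epsilon> c *\<^sub>C b) (\<Delta> a))"
    by (simp add: clinear_commute_tensor_lift[OF assms] convolution_def convolution_unit_def
        clinear_scaleC[OF assms] scaleC_mult_right)
  then show "convolution f convolution_unit a = f a"
    by (simp add: counit_right)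
qed

lemma convolution_inverse_unique:
  assumes "clinear f" "clinear g" "clinear k"
    and "convolution f g = convolution_unit" "convolution g k = convolution_unit"
  shows "f = k"
  by (metis assms convolution_assoc convolution_unit_left convolution_unit_right)

lemma convolution_antipode_id: "convolution S (\<lambda>a. a) = convolution_unit"
  by (simp add: fun_eq_iff convolution_def convolution_unit_def antipode_left)

text \<open>Both sides are convolution inverses of \<open>\<Delta>\<close>. For the left-hand side this is the antipode axiom
  under the algebra map \<open>\<Delta>\<close>. For the right-hand side \<open>?g\<close> it is a computation with four Sweedler
  factors, \<open>a\<^sub>1 S(a\<^sub>4) \<otimes> a\<^sub>2 S(a\<^sub>3)\<close>, which collapses from the inside: \<open>inner\<close> cancels
  \<open>a\<^sub>2 S(a\<^sub>3)\<close>, and then \<open>a\<^sub>1 S(a\<^sub>2) \<otimes> 1\<close> remains.\<close>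

lemma coproduct_antipode:
  "\<Delta> (S a) = tensor_flip (tensor_map S S (\<Delta> a))"
proof -
  let ?g = "\<lambda>a. tensor_flip (tensor_map S S (\<Delta> a))"
  note lin = multilinear_simps counit_add counit_scaleC
    linear_coproduct[THEN clinear_add] linear_coproduct[THEN clinear_scaleC]
    linear_antipode[THEN clinear_add] linear_antipode[THEN clinear_scaleC]
    clinear_tensor_map[OF linear_antipode linear_antipode, THEN clinear_add]
    clinear_tensor_map[OF linear_antipode linear_antipode, THEN clinear_scaleC]
  have g: "?g x = tensor_lift (\<lambda>b c. S c \<otimes> S b) (\<Delta> x)" for x
    by (simp add: tensor_map_def clinear_commute_tensor_lift[OF clinear_tensor_flip]
        tensor_flip_tensor)
  have inner: "tensor_lift (\<lambda>b x. (1 \<otimes> b) * ?g x) (\<Delta> h) = S h \<otimes> 1" for h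
  proof -
    have "tensor_lift (\<lambda>b x. (1 \<otimes> b) * ?g x) (\<Delta> h)
        = tensor_lift (\<lambda>b x. tensor_lift (\<lambda>c d. S d \<otimes> (b * S c)) (\<Delta> x)) (\<Delta> h)"
      unfolding g
      by (subst clinear_commute_tensor_lift)
        (simp_all add: clinear_iff lin tensor_times_tensor)
    also have "\<dots> = tensor_lift (\<lambda>x d. tensor_lift (\<lambda>b c. S d \<otimes> (b * S c)) (\<Delta> x)) (\<Delta> h)"
      by (rule coassoc_lift[symmetric]) (simp add: ctrilinear_def cbilinear_iff lin)
    also have "\<dots> = tensor_lift (\<lambda>x d. (\<epsilon> x *\<^sub>C S d) \<otimes> 1) (\<Delta> h)"
      by (subst clinear_commute_tensor_lift[symmetric])
        (simp_all add: clinear_iff antipode_right lin)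
    also have "\<dots> = S (tensor_lift (\<lambda>x d. \<epsilon> x *\<^sub>C d) (\<Delta> h)) \<otimes> 1"
      by (subst clinear_commute_tensor_lift[of "\<lambda>y. S y \<otimes> 1"])
        (simp_all add: clinear_iff lin)
    finally show ?thesis by (simp add: counit_left)
  qed
  have "(\<lambda>a. \<Delta> (S a)) = ?g"
  proof (rule convolution_inverse_unique)
    show "clinear (\<lambda>a. \<Delta> (S a))" "clinear ?g" "clinear \<Delta>"
      by (simp_all add: clinear_iff lin)
    have "tensor_lift (\<lambda>b c. \<Delta> (S b) * \<Delta> c) (\<Delta> h) = \<Delta> (tensor_lift (\<lambda>b c. S b * c) (\<Delta> h))" for h
      by (subst clinear_commute_tensor_lift) (simp_all add: linear_coproduct coproduct_mult)
    then show "convolution (\<lambda>a. \<Delta> (S a)) \<Delta> = convolution_unit"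
      by (simp add: fun_eq_iff convolution_def convolution_unit_def antipode_left
          clinear_scaleC[OF linear_coproduct] coproduct_one)
    have "tensor_lift (\<lambda>x c. \<Delta> x * ?g c) (\<Delta> h) = \<epsilon> h *\<^sub>C 1" for h
    proof -
      have split: "\<Delta> x * ?g c = tensor_lift (\<lambda>a b. (a \<otimes> b) * ?g c) (\<Delta> x)" for x c
      proof -
        have "tensor_lift (\<lambda>a b. a \<otimes> b) t = t" for t :: "'h \<otimes> 'h"
          using tensor_map_id[of t] by (simp add: tensor_map_def)
        then show ?thesis
          using clinear_commute_tensor_lift[of "\<lambda>w. w * ?g c" "\<lambda>a b. a \<otimes> b" "\<Delta> x"]
          by (simp add: clinear_iff lin)
      qed
      have "tensor_lift (\<lambda>x c. \<Delta> x * ?g c) (\<Delta> h)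
          = tensor_lift (\<lambda>a x. tensor_lift (\<lambda>b c. (a \<otimes> b) * ?g c) (\<Delta> x)) (\<Delta> h)"
        unfolding split
        by (rule coassoc_lift) (simp add: ctrilinear_def cbilinear_iff lin)
      also have "\<dots> = tensor_lift (\<lambda>a x. (a \<otimes> 1) * (S x \<otimes> 1)) (\<Delta> h)"
        unfolding inner[symmetric]
        by (subst clinear_commute_tensor_lift)
          (simp_all add: clinear_iff lin mult.assoc[symmetric] tensor_times_tensor)
      also have "\<dots> = tensor_lift (\<lambda>a x. a * S x) (\<Delta> h) \<otimes> 1"
        by (subst clinear_commute_tensor_lift[of "\<lambda>y. y \<otimes> 1"])
          (simp_all add: clinear_iff lin tensor_times_tensor)
      finally show ?thesis
        by (simp add: antipode_right one_tensor_def tensor_scaleC_left)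
    qed
    then show "convolution \<Delta> ?g = convolution_unit"
      by (simp add: fun_eq_iff convolution_def convolution_unit_def)
  qed
  then show ?thesis by (rule fun_cong)
qed


section \<open>The antipode and the universal R-matrix\<close>

text \<open>Applying \<open>a \<otimes> b \<otimes> c \<mapsto> f a * g b \<otimes> c\<close> to the hexagon identity turns the coproduct on the left
  into a convolution and the two legs on the right into a product. The mirror image below uses the
  second and third legs; there \<open>leg12\<close> precedes \<open>leg13\<close>, which is the order satisfied by the
  inverse of a universal R-matrix, not by the R-matrix itself.\<close>

lemma tensor_map_convolution_left:
  fixes X :: "'h \<otimes> 'h" and f g :: "'h \<Rightarrow> 'h"
  assumes X: "tensor_map \<Delta> id X = leg13 X * leg23 X" and lin: "clinear f" "clinear g"
  shows "tensor_map (convolution f g) id X = tensor_map f id X * tensor_map g id X"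
proof -
  let ?T = "\<lambda>a b c. (f a * g b) \<otimes> c"
  have T: "ctrilinear ?T"
    by (simp add: ctrilinear_def cbilinear_iff multilinear_simps
        lin[THEN clinear_add] lin[THEN clinear_scaleC])
  note L = cbilinear_lift_left[OF T]
  have B: "cbilinear (\<lambda>a b. ?T a b c)" for c
    by (rule ctrilinear_first_two[OF T])
  have legs: "tensor_lift (\<lambda>t c. tensor_lift (\<lambda>a b. ?T a b c) t) (leg13 y * leg23 z)
      = tensor_map f id y * tensor_map g id z" for y z
  proof (induction y rule: tensor_induct)
    case (tensor a b)
    show ?case
      by (induction z rule: tensor_induct)
        (simp_all add: leg13_tensor leg23_tensor tensor_times_tensor tensor_lift_tensor L B
          tensor_map_tensor lin tensor_lift_add multilinear_simps)
  qed (simp add: lin tensor_lift_add L multilinear_simps)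
  have "tensor_map (convolution f g) id X
      = tensor_lift (\<lambda>x c. tensor_lift (\<lambda>a b. ?T a b c) (\<Delta> x)) X"
    unfolding tensor_map_def convolution_def id_def
    by (subst clinear_commute_tensor_lift[of "\<lambda>y. y \<otimes> z" for z])
      (simp_all add: clinear_iff multilinear_simps)
  also have "\<dots> = tensor_lift (\<lambda>t c. tensor_lift (\<lambda>a b. ?T a b c) t) (tensor_map \<Delta> id X)"
    by (subst tensor_lift_tensor_map) (simp_all add: L linear_coproduct clinear_id)
  finally show ?thesis by (simp add: X legs)
qed

lemma tensor_map_convolution_right:
  fixes X :: "'h \<otimes> 'h" and f g :: "'h \<Rightarrow> 'h"
  assumes X: "tensor_map id \<Delta> X = tensor_assoc (leg12 X * leg13 X)"
    and lin: "clinear f" "clinear g"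
  shows "tensor_map id (convolution f g) X = tensor_map id f X * tensor_map id g X"
proof -
  let ?T = "\<lambda>a b c. a \<otimes> (f b * g c)"
  have T: "ctrilinear ?T"
    by (simp add: ctrilinear_def cbilinear_iff multilinear_simps
        lin[THEN clinear_add] lin[THEN clinear_scaleC])
  note L = cbilinear_lift_left[OF T]
  have B: "cbilinear (\<lambda>a b. ?T a b c)" for c
    by (rule ctrilinear_first_two[OF T])
  have legs: "tensor_lift (\<lambda>t c. tensor_lift (\<lambda>a b. ?T a b c) t) (leg12 y * leg13 z)
      = tensor_map id f y * tensor_map id g z" for y z
  proof (induction y rule: tensor_induct)
    case (tensor a b)
    show ?case
      by (induction z rule: tensor_induct)
        (simp_all add: leg12_tensor leg13_tensor tensor_times_tensor tensor_lift_tensor L B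
          tensor_map_tensor lin tensor_lift_add multilinear_simps)
  qed (simp add: lin tensor_lift_add L multilinear_simps)
  have "tensor_map id (convolution f g) X
      = tensor_lift (\<lambda>a x. tensor_lift (?T a) (\<Delta> x)) X"
    unfolding tensor_map_def convolution_def id_def
    by (subst clinear_commute_tensor_lift[of "\<lambda>y. z \<otimes> y" for z])
      (simp_all add: clinear_iff multilinear_simps)
  also have "\<dots> = tensor_lift (\<lambda>a. tensor_lift (?T a)) (tensor_map id \<Delta> X)"
    by (subst tensor_lift_tensor_map)
      (simp_all add: cbilinear_lift_right[OF T] linear_coproduct clinear_id)
  finally show ?thesis by (simp add: X legs tensor_lift_tensor_assoc[OF T])
qed

text \<open>Multiplicativity on \<open>\<eta>\<epsilon> \<star> id = id\<close>, with \<open>\<eta>\<epsilon>\<close> the convolution unit, shows that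
  \<open>(\<eta>\<epsilon> \<otimes> id) X\<close> acts trivially on the invertible \<open>X\<close>, hence is \<open>1\<close>; on \<open>S \<star> id = \<eta>\<epsilon>\<close> it then
  shows that \<open>(S \<otimes> id) X\<close> is inverse to \<open>X\<close>.\<close>

lemma tensor_map_antipode_left:
  assumes X: "tensor_map \<Delta> id X = leg13 X * leg23 X" and inv: "X * Y = 1"
  shows "tensor_map S id X = Y"
proof -
  have X_id: "tensor_map (\<lambda>a. a) id X = X"
    by (simp add: id_def tensor_map_id)
  have "tensor_map convolution_unit id X * X = X"
    using tensor_map_convolution_left[OF X clinear_convolution_unit clinear_ident]
    by (simp add: convolution_unit_left clinear_ident X_id)
  then have "tensor_map (convolution_unit :: 'h \<Rightarrow> 'h) id X = 1"
    using inv by (rule left_neutral_of_right_invertible)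
  then have "tensor_map S id X * X = 1"
    using tensor_map_convolution_left[OF X linear_antipode clinear_ident]
    by (simp add: convolution_antipode_id X_id)
  then show ?thesis
    using inv by (rule left_inverse_eq_right_inverse)
qed

lemma tensor_map_antipode_right:
  assumes X: "tensor_map id \<Delta> X = tensor_assoc (leg12 X * leg13 X)" and inv: "X * Y = 1"
  shows "tensor_map id S X = Y"
proof -
  have X_id: "tensor_map id (\<lambda>a. a) X = X"
    by (simp add: id_def tensor_map_id)
  have "tensor_map id convolution_unit X * X = X"
    using tensor_map_convolution_right[OF X clinear_convolution_unit clinear_ident]
    by (simp add: convolution_unit_left clinear_ident X_id)
  then have "tensor_map id (convolution_unit :: 'h \<Rightarrow> 'h) X = 1"
    using inv by (rule left_neutral_of_right_invertible)
  then have "tensor_map id S X * X = 1"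
    using tensor_map_convolution_right[OF X linear_antipode clinear_ident]
    by (simp add: convolution_antipode_id X_id)
  then show ?thesis
    using inv by (rule left_inverse_eq_right_inverse)
qed

end

text \<open>The second leg is treated for the inverse \<open>Q\<close> instead of \<open>R\<close>: in \<open>(id \<otimes> \<Delta>) R = R\<^sub>1\<^sub>3 R\<^sub>1\<^sub>2\<close> the legs stand in the wrong order for a convolution,
  and inversion reverses them to \<open>(id \<otimes> \<Delta>) Q = Q\<^sub>1\<^sub>2 Q\<^sub>1\<^sub>3\<close>.\<close>

lemma (in quasitriangular_hopf_star_algebra) antipode_R: "tensor_map S S R = R"
proof -
  obtain Q where Q: "R * Q = 1" "Q * R = 1"
    using R_invertible_intertwines by blast
  let ?D = "tensor_map id \<Delta>" and ?Q3 = "tensor_assoc (leg12 Q * leg13 Q)"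
  have D_mult: "?D (x * y) = ?D x * ?D y" for x y
    by (rule tensor_map_mult) (simp_all add: clinear_id linear_coproduct coproduct_mult)
  have one: "?D 1 = 1" "leg12 1 = 1" "leg13 1 = 1" "tensor_assoc 1 = 1"
    by (simp_all add: one_tensor_def tensor_map_tensor clinear_id linear_coproduct coproduct_one
        leg12_tensor leg13_tensor tensor_assoc_tensor)
  have "?D Q * ?D R = 1"
    by (simp add: D_mult[symmetric] Q one)
  moreover have "?D R * ?Q3 = 1"
  proof -
    have "?D R * ?Q3 = tensor_assoc (leg13 R * (leg12 R * leg12 Q) * leg13 Q)"
      by (simp add: id_coproduct_R tensor_assoc_mult mult.assoc)
    also have "\<dots> = 1"
      by (simp add: leg12_mult[symmetric] leg13_mult[symmetric] Q one)
    finally show ?thesis .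
  qed
  ultimately have "?D Q = ?Q3"
    by (rule left_inverse_eq_right_inverse)
  then have "tensor_map id S Q = R"
    by (rule tensor_map_antipode_right) (rule Q)
  moreover have "tensor_map S id R = Q"
    by (rule tensor_map_antipode_left[OF coproduct_id_R Q(1)])
  ultimately have "tensor_map id S (tensor_map S id R) = R" by simp
  then show ?thesis
    by (simp add: tensor_map_compose clinear_id linear_antipode)
qed


section \<open>The coordinate-wise action\<close>

lemma cbilinear_act2:
  assumes "cbilinear actU" "cbilinear actV"
  shows "cbilinear (act2 actU actV)"
proof -
  have l: "clinear (actU a)" "clinear (actV b)" for a b
    using assms by (auto simp: cbilinear_def)
  have B: "cbilinear (\<lambda>a b. tensor_map (actU a) (actV b) t)" for t
    unfolding cbilinear_iff tensor_map_def
    using assms by (simp add: cbilinear_iff multilinear_simps)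
  show ?thesis
    unfolding cbilinear_iff act2_def
    by (simp add: tensor_lift_add tensor_lift_scaleC B multilinear_simps l)
qed

lemma act2_mult:
  assumes "left_module actU" "left_module actV"
  shows "act2 actU actV (x * y) t = act2 actU actV x (act2 actU actV y t)"
proof -
  have B: "cbilinear actU" "cbilinear actV"
    using assms by (simp_all add: left_module_def)
  note act2_linear = cbilinear_add_left[OF cbilinear_act2[OF B]]
    cbilinear_add_right[OF cbilinear_act2[OF B]] distrib_left distrib_right
  show ?thesis
  proof (induction x rule: tensor_induct)
    case (tensor a b)
    show ?case
    proof (induction y rule: tensor_induct)
      case (tensor c d)
      show ?case
        by (induction t rule: tensor_induct)
          (use assms in \<open>simp_all add: act2_linear tensor_times_tensor act2_tensor B left_module_def\<close>)
    qed (simp add: act2_linear)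
  qed (simp add: act2_linear)
qed

lemma act2_one:
  assumes "left_module actU" "left_module actV"
  shows "act2 actU actV 1 t = t"
proof -
  have B: "cbilinear actU" "cbilinear actV"
    using assms by (simp_all add: left_module_def)
  show ?thesis
    by (induction t rule: tensor_induct)
      (use assms in \<open>simp_all add: one_tensor_def act2_tensor B left_module_def
        cbilinear_add_right[OF cbilinear_act2[OF B]]\<close>)
qed

lemma tensor_flip_act2:
  assumes "cbilinear actU" "cbilinear actV"
  shows "tensor_flip (act2 actU actV x t) = act2 actV actU (tensor_flip x) (tensor_flip t)"
proof -
  note act2_linear = cbilinear_act2[OF assms, THEN cbilinear_add_left]
    cbilinear_act2[OF assms, THEN cbilinear_add_right]
    cbilinear_act2[OF assms(2,1), THEN cbilinear_add_left]
    cbilinear_act2[OF assms(2,1), THEN cbilinear_add_right]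
    clinear_add[OF clinear_tensor_flip]
  show ?thesis
  proof (induction x rule: tensor_induct)
    case (tensor a b)
    show ?case
      by (induction t rule: tensor_induct)
        (simp_all add: act2_linear act2_tensor assms tensor_flip_tensor)
  qed (simp add: act2_linear)
qed

lemma (in hopf_algebra) left_module_tensor_act:
  assumes "left_module actU" "left_module actV"
  shows "left_module (tensor_act \<Delta> actU actV)"
proof -
  have "cbilinear (act2 actU actV)"
    using assms by (simp add: left_module_def cbilinear_act2)
  then have "cbilinear (\<lambda>a. act2 actU actV (\<Delta> a))"
    by (simp add: cbilinear_iff clinear_add[OF linear_coproduct] clinear_scaleC[OF linear_coproduct])
  then show ?thesis
    unfolding left_module_def tensor_act_def[abs_def]
    by (simp add: assms act2_one act2_mult coproduct_one coproduct_mult)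
qed

lemma (in quasitriangular_hopf_star_algebra) module_map_braiding:
  assumes "left_module actU" "left_module actV"
  shows "module_map (tensor_act \<Delta> actU actV) (tensor_act \<Delta> actV actU) (braiding R actU actV)"
proof -
  have B: "cbilinear actU" "cbilinear actV"
    using assms by (simp_all add: left_module_def)
  obtain Q where Q: "Q * R = 1" "\<And>a. R * \<Delta> a * Q = tensor_flip (\<Delta> a)"
    using R_invertible_intertwines by blast
  have comm: "R * \<Delta> a = tensor_flip (\<Delta> a) * R" for a
    by (simp add: Q(2)[symmetric] mult.assoc Q(1))
  have "clinear (\<lambda>t. tensor_flip (act2 actU actV R t))"
    by (simp add: clinear_iff multilinear_simps cbilinear_add_right[OF cbilinear_act2[OF B]]
        cbilinear_scaleC_right[OF cbilinear_act2[OF B]])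
  moreover have "tensor_flip (act2 actU actV R (act2 actU actV (\<Delta> a) t))
      = act2 actV actU (\<Delta> a) (tensor_flip (act2 actU actV R t))" for a t
    by (simp add: act2_mult[OF assms, symmetric] comm)
      (simp add: act2_mult[OF assms] tensor_flip_act2[OF B] tensor_flip_flip)
  ultimately show ?thesis
    by (simp add: module_map_def braiding_def tensor_act_def comp_def)
qed


section \<open>The star structure on the tensor square\<close>

lemma star_structure_involutive:
  assumes "st \<circ> conj_map st = double_conj"
  shows "st (bar (st (bar v))) = v"
  using fun_cong[OF assms, of "bar (bar v)"] by (simp add: conj_map_def double_conj_def)

lemma tensor_st_add:
  assumes "clinear st"
  shows "tensor_st st (bar (s + t)) = tensor_st st (bar s) + tensor_st st (bar t)"
  by (simp add: bar_add clinear_add[OF tensor_st_tensor(2)[OF assms]])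

lemma tensor_st_involutive:
  assumes "clinear st" "st \<circ> conj_map st = double_conj"
  shows "tensor_st st (bar (tensor_st st (bar t))) = t"
  by (induction t rule: tensor_induct)
    (simp_all add: tensor_st_tensor(1)[OF assms(1)] tensor_st_add[OF assms(1)]
      star_structure_involutive[OF assms(2)])

lemma tensor_st_flip:
  assumes "clinear st"
  shows "tensor_st st (bar (tensor_flip t)) = tensor_flip (tensor_st st (bar t))"
  by (induction t rule: tensor_induct)
    (simp_all add: tensor_st_tensor(1)[OF assms] tensor_st_add[OF assms] tensor_flip_tensor
      clinear_add[OF clinear_tensor_flip])

context hopf_star_algebra
begin

lemma antilinear_star_tensor:
  "antilinear_tensor_map star star (a \<otimes> b) = star a \<otimes> star b"
  by (rule antilinear_tensor_map_tensor) (simp_all add: star_add star_scaleC)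

lemma antilinear_star_add:
  "antilinear_tensor_map star star (x + y)
    = antilinear_tensor_map star star x + antilinear_tensor_map star star y"
proof -
  have "cbilinear (\<lambda>a b. bar (star a \<otimes> star b))"
    by (simp add: cbilinear_iff star_add star_scaleC bar_add bar_scaleC multilinear_simps)
  then show ?thesis
    by (simp add: antilinear_tensor_map_def tensor_lift_add unbar_add)
qed

text \<open>This is the module map condition for \<open>st\<close>, conjugated by the involution; it moves an arbitrary
  element \<open>a\<close> past the involution, not only one of the form \<open>star (S a)\<close>.\<close>

lemma star_module_act:
  assumes "star_module S star act st"
  shows "st (bar (act a v)) = act (star (S a)) (st (bar v))"
proof -
  have st: "st (bar (act (star (S a)) w)) = act a (st (bar w))" for w
  proof -
    have "st (conj_act S star act a (bar w)) = act a (st (bar w))"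
      using assms by (simp add: star_module_def module_map_def)
    then show ?thesis by (simp add: conj_act_def)
  qed
  have "st \<circ> conj_map st = double_conj"
    using assms by (simp add: star_module_def)
  note inv = star_structure_involutive[OF this]
  have "st (bar (act a v)) = st (bar (act a (st (bar (st (bar v))))))"
    by (simp add: inv)
  also have "\<dots> = st (bar (st (bar (act (star (S a)) (st (bar v))))))"
    by (simp add: st)
  finally show ?thesis by (simp add: inv)
qed

text \<open>The flip arises because the involution on the tensor square exchanges the factors.\<close>

lemma tensor_st_act2:
  assumes st: "star_module S star act st"
  shows "tensor_st st (bar (act2 act act x t))
    = act2 act act (tensor_flip (antilinear_tensor_map star star (tensor_map S S x)))
        (tensor_st st (bar t))"
proof -
  have B: "cbilinear act" and lin: "clinear st"
    using st by (simp_all add: star_module_def left_module_def module_map_def)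
  note add = cbilinear_act2[OF B B, THEN cbilinear_add_left]
    cbilinear_act2[OF B B, THEN cbilinear_add_right] tensor_st_add[OF lin]
    clinear_add[OF clinear_tensor_flip] antilinear_star_add
    clinear_add[OF clinear_tensor_map[OF linear_antipode linear_antipode]]
  show ?thesis
  proof (induction x rule: tensor_induct)
    case (tensor a b)
    show ?case
      by (induction t rule: tensor_induct)
        (simp_all add: add act2_tensor[OF B B] tensor_st_tensor(1)[OF lin] tensor_flip_tensor
          antilinear_star_tensor tensor_map_tensor linear_antipode star_module_act[OF st])
  qed (simp add: add)
qed

lemma antilinear_star_flip:
  "antilinear_tensor_map star star (tensor_flip x) = tensor_flip (antilinear_tensor_map star star x)"
  by (induction x rule: tensor_induct)
    (simp_all add: tensor_flip_tensor antilinear_star_tensor antilinear_star_add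
      clinear_add[OF clinear_tensor_flip])

lemma star_module_tensor:
  assumes st: "star_module S star act st"
  shows "star_module S star (tensor_act \<Delta> act act) (tensor_st st)"
proof -
  have lin: "clinear st" and inv: "st \<circ> conj_map st = double_conj" and M: "left_module act"
    using st by (simp_all add: star_module_def module_map_def)
  note inv2 = tensor_st_involutive[OF lin inv]
  have act: "tensor_st st (bar (tensor_act \<Delta> act act a t))
      = tensor_act \<Delta> act act (star (S a)) (tensor_st st (bar t))" for a t
    by (simp add: tensor_act_def tensor_st_act2[OF st] coproduct_star coproduct_antipode
        antilinear_star_flip)
  have "tensor_st st (bar (tensor_act \<Delta> act act (star (S a)) t))
      = tensor_act \<Delta> act act a (tensor_st st (bar t))" for a t
    \<comment> \<open>Conjugating \<open>act\<close> by the involution recovers the direction that the definition asks for.\<close>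
    using arg_cong[OF act[of a "tensor_st st (bar t)"], of "\<lambda>t. tensor_st st (bar t)"]
    by (simp add: inv2)
  then have "module_map (conj_act S star (tensor_act \<Delta> act act)) (tensor_act \<Delta> act act)
      (tensor_st st)"
    unfolding module_map_def conj_act_def
    by (metis conj_space.collapse tensor_st_tensor(2)[OF lin])
  moreover have "tensor_st st \<circ> conj_map (tensor_st st) = double_conj"
    unfolding fun_eq_iff comp_apply conj_map_def double_conj_def
    by (metis conj_space.collapse inv2)
  ultimately show ?thesis
    using left_module_tensor_act[OF M M] by (simp add: star_module_def)
qed

end

theorem proposition9p12:
  fixes \<Delta> :: "'h::complex_algebra_1 \<Rightarrow> 'h \<otimes> 'h"
    and \<epsilon> :: "'h \<Rightarrow> complex"
    and S star :: "'h \<Rightarrow> 'h"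
    and R :: "'h \<otimes> 'h"
    and act :: "'h \<Rightarrow> 'v::complex_vector \<Rightarrow> 'v"
    and st :: "'v conj_space \<Rightarrow> 'v"
  assumes "quasitriangular_hopf_star_algebra \<Delta> \<epsilon> S star R"
    and "star_module S star act st"
    and "real_R_matrix star R"
  shows "braiding R act act \<circ> tensor_st st = tensor_st st \<circ> conj_map (braiding R act act) \<and>
    star_module_morphism S star
      (tensor_act \<Delta> act act) (tensor_st st) (tensor_act \<Delta> act act) (tensor_st st)
      (braiding R act act)"
proof -
  interpret quasitriangular_hopf_star_algebra \<Delta> \<epsilon> S star R by (rule assms(1))
  have M: "left_module act" and lin: "clinear st"
    using assms(2) by (simp_all add: star_module_def module_map_def)
  have real: "antilinear_tensor_map star star R = tensor_flip R"
    using assms(3) by (simp add: real_R_matrix_def)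
  have "tensor_st st (bar (braiding R act act t)) = braiding R act act (tensor_st st (bar t))" for t
    by (simp add: braiding_def tensor_st_flip[OF lin] tensor_st_act2[OF assms(2)] antipode_R
        real tensor_flip_flip)
  then have commutes: "braiding R act act \<circ> tensor_st st = tensor_st st \<circ> conj_map (braiding R act act)"
    unfolding fun_eq_iff comp_apply conj_map_def by (metis conj_space.collapse)
  then show ?thesis
    using star_module_tensor[OF assms(2)] module_map_braiding[OF M M]
    by (simp add: star_module_morphism_def)
qed

end
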